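(* Let $\mathcal{H}$ be a complex Hilbert space of finite dimension $d\ge 2$. Every maximal MUB-POVM $\mathcal{M}$ on $\mathcal{H}$ has maximal completeness stability, i.e. $s(\mathcal{M})\ge s(\mathcal{A})$ for every POVM $\mathcal{A}$ on $\mathcal{H}$. Furthermore, every non-maximal MUB-POVM on $\mathcal{H}$ (one built from fewer than $d+1$ bases) is informationally incomplete.
   Context: $\mathcal{L}(\mathcal{H})$ is the space of linear operators on $\mathcal{H}$ with the Hilbert–Schmidt inner product $\langle A|B\rangle=\mathrm{Tr}[A^\dagger B]$; $|A\rangle$ denotes $A$ regarded as a vector of this Hilbert space. A POVM $\mathcal{A}=\{A_a\}$ on $\mathcal{H}$ is a finite family of nonzero positive semidefinite operators (effects) with $\sum_a A_a=I$. It is informationally complete if its effects span $\mathcal{L}(\mathcal{H})$, and informationally incomplete otherwise. Its scaled frame operator is the linear operator on $\mathcal{L}(\mathcal{H})$ $F_s(\mathcal{A})=\sum_a |A_a\rangle\langle A_a|/\langle A_a|I\rangle$, i.e. $F_s(\mathcal{A})(X)=\sum_a\frac{\mathrm{Tr}[A_aX]}{\mathrm{Tr}[A_a]}A_a$. The completeness stability $s(\mathcal{A})$ is the minimum eigenvalue of $F_s(\mathcal{A})$. A set of mutually unbiased bases (MUB) is a set of $k\ge1$ orthonormal bases $\{|m_{j1}\rangle,\dots,|m_{jd}\rangle\}$, $j=1,\dots,k$, of $\mathcal{H}$ with $|\langle m_{ja}|m_{lb}\rangle|^2=1/d$ for all $j\ne l$ and all $a,b$. Such a set has at most $d+1$ bases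 and is called maximal if $k=d+1$. The associated MUB-POVM has the $kd$ effects $\Pi_{ja}=\frac1k|m_{ja}\rangle\langle m_{ja}|$, $1\le j\le k$, $1\le a\le d$; it is called maximal if $k=d+1$ and non-maximal if $k<d+1$. *)

theory Defs
  imports Complex_Main "HOL-Library.Function_Algebras"
begin

text \<open>
  Finite-dimensional complex inner product spaces (automatically complete, hence Hilbert spaces).
  The inner product is conjugate-linear in the first and linear in the second argument.
\<close>

class fin_dim_complex_hilbert = ab_group_add +
  fixes scaleC :: "complex \<Rightarrow> 'a \<Rightarrow> 'a"  (infixr "*\<^sub>C" 75)
    and cinner :: "'a \<Rightarrow> 'a \<Rightarrow> complex"
  assumes scaleC_add_right: "c *\<^sub>C (x + y) = c *\<^sub>C x + c *\<^sub>C y"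
    and scaleC_add_left: "(c + c') *\<^sub>C x = c *\<^sub>C x + c' *\<^sub>C x"
    and scaleC_scaleC: "c *\<^sub>C c' *\<^sub>C x = (c * c') *\<^sub>C x"
    and scaleC_one: "1 *\<^sub>C x = x"
    and fin_dim: "\<exists>B. finite B \<and> (\<forall>x. \<exists>c. x = (\<Sum>b\<in>B. c b *\<^sub>C b))"
    and cinner_commute: "cinner x y = cnj (cinner y x)"
    and cinner_add_right: "cinner x (y + z) = cinner x y + cinner x z"
    and cinner_scaleC_right: "cinner x (c *\<^sub>C y) = c * cinner x y"
    and cinner_pos: "x \<noteq> 0 \<Longrightarrow> 0 < Re (cinner x x)"

interpretation cvec: vector_space "scaleC :: complex \<Rightarrow> 'h \<Rightarrow> 'h::fin_dim_complex_hilbert"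
  by unfold_locales
    (simp_all add: scaleC_add_right scaleC_add_left scaleC_scaleC scaleC_one)

abbreviation dimC :: "'h::fin_dim_complex_hilbert itself \<Rightarrow> nat" where
  "dimC _ \<equiv> cvec.dim (UNIV :: 'h set)"

type_synonym 'h oper = "'h \<Rightarrow> 'h"

definition op_scale :: "complex \<Rightarrow> 'h::fin_dim_complex_hilbert oper \<Rightarrow> 'h oper" where
  "op_scale c A = (\<lambda>x. c *\<^sub>C A x)"

interpretation cop: vector_space "op_scale :: complex \<Rightarrow> 'h oper \<Rightarrow> 'h::fin_dim_complex_hilbert oper"
  by unfold_locales
    (simp_all add: op_scale_def fun_eq_iff scaleC_add_right scaleC_add_left scaleC_scaleC scaleC_one)

definition linear_ops :: "'h::fin_dim_complex_hilbert oper set" where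
  "linear_ops = {A. Vector_Spaces.linear scaleC scaleC A}"

text \<open>
  The trace, i.e. the sum of the diagonal matrix entries with respect to a basis of the space.
  The chosen basis does not matter, see \<open>op_trace_eq\<close> below.
\<close>

definition op_trace :: "'h::fin_dim_complex_hilbert oper \<Rightarrow> complex" where
  "op_trace A = (let B = cvec.extend_basis {} in \<Sum>b\<in>B. cvec.representation B (A b) b)"

lemma finite_basis:
  fixes B :: "'h::fin_dim_complex_hilbert set"
  assumes "cvec.independent B"
  shows "finite B"
proof -
  obtain S :: "'h set" where S: "finite S" "\<And>x. \<exists>c. x = (\<Sum>b\<in>S. c b *\<^sub>C b)"
    using fin_dim by blast
  have "x \<in> cvec.span S" for x
  proof -
    obtain c where "x = (\<Sum>b\<in>S. c b *\<^sub>C b)" using S(2) by blast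
    then show ?thesis
      by (auto intro: cvec.span_sum cvec.span_scale cvec.span_base)
  qed
  then show ?thesis
    using cvec.independent_span_bound[OF S(1) assms] by blast
qed

lemma op_trace_eq:
  fixes B :: "'h::fin_dim_complex_hilbert set"
  assumes A: "A \<in> linear_ops" and B: "cvec.independent B" "cvec.span B = UNIV"
  shows "op_trace A = (\<Sum>b\<in>B. cvec.representation B (A b) b)"
proof -
  interpret A: Vector_Spaces.linear scaleC scaleC A
    using A by (simp add: linear_ops_def)
  define C where "C = cvec.extend_basis ({} :: 'h set)"
  have C: "cvec.independent C" "cvec.span C = UNIV"
    using cvec.independent_extend_basis[OF cvec.independent_empty]
      cvec.span_extend_basis[OF cvec.independent_empty] by (simp_all add: C_def)
  note fin = finite_basis[OF B(1)] finite_basis[OF C(1)]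
  have expand: "A x = (\<Sum>c\<in>D. cvec.representation D x c *\<^sub>C A c)"
    if "cvec.independent D" "cvec.span D = UNIV" for x and D :: "'h set"
  proof -
    have "x = (\<Sum>c\<in>D. cvec.representation D x c *\<^sub>C c)"
      using cvec.sum_representation_eq[OF that(1), of x D] that finite_basis[OF that(1)] by simp
    then have "A x = A (\<Sum>c\<in>D. cvec.representation D x c *\<^sub>C c)" by simp
    then show ?thesis by (simp only: A.sum A.scale)
  qed
  have repr: "cvec.representation D (\<Sum>c\<in>E. f c *\<^sub>C v c) b
      = (\<Sum>c\<in>E. f c * cvec.representation D (v c) b)"
    if "cvec.independent D" "cvec.span D = UNIV" for D E :: "'h set" and f v b
    using that by (simp add: cvec.representation_sum cvec.representation_scale)
  have self: "x = (\<Sum>b\<in>B. cvec.representation B x b *\<^sub>C b)" for x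
    using cvec.sum_representation_eq[OF B(1), of x B] B fin by simp
  have "(\<Sum>b\<in>B. cvec.representation B (A b) b)
      = (\<Sum>b\<in>B. \<Sum>c\<in>C. cvec.representation C b c * cvec.representation B (A c) b)"
    by (intro sum.cong refl) (subst expand[OF C], simp add: repr[OF B])
  also have "\<dots> = (\<Sum>c\<in>C. \<Sum>b\<in>B. cvec.representation B (A c) b * cvec.representation C b c)"
    by (subst sum.swap) (simp add: mult.commute)
  also have "\<dots> = (\<Sum>c\<in>C. cvec.representation C (\<Sum>b\<in>B. cvec.representation B (A c) b *\<^sub>C b) c)"
    by (simp add: repr[OF C])
  also have "\<dots> = op_trace A"
    by (simp add: self[symmetric] op_trace_def C_def Let_def)
  finally show ?thesis by simp
qed

text \<open>On a complex space positivity of the quadratic form includes self-adjointness.\<close>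

definition pos_semidef :: "'h::fin_dim_complex_hilbert oper \<Rightarrow> bool" where
  "pos_semidef A \<longleftrightarrow>
     A \<in> linear_ops \<and> (\<forall>x. Im (cinner x (A x)) = 0 \<and> 0 \<le> Re (cinner x (A x)))"

definition povm :: "'i set \<Rightarrow> ('i \<Rightarrow> 'h::fin_dim_complex_hilbert oper) \<Rightarrow> bool" where
  "povm I A \<longleftrightarrow>
     finite I \<and> (\<forall>a\<in>I. pos_semidef (A a) \<and> A a \<noteq> 0) \<and> (\<Sum>a\<in>I. A a) = id"

definition informationally_complete :: "'i set \<Rightarrow> ('i \<Rightarrow> 'h::fin_dim_complex_hilbert oper) \<Rightarrow> bool" where
  "informationally_complete I A \<longleftrightarrow> cop.span (A ` I) = linear_ops"

definition scaled_frame ::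
    "'i set \<Rightarrow> ('i \<Rightarrow> 'h::fin_dim_complex_hilbert oper) \<Rightarrow> 'h oper \<Rightarrow> 'h oper" where
  "scaled_frame I A X = (\<Sum>a\<in>I. op_scale (op_trace (A a \<circ> X) / op_trace (A a)) (A a))"

definition superop_eigenvalue ::
    "('h::fin_dim_complex_hilbert oper \<Rightarrow> 'h oper) \<Rightarrow> complex \<Rightarrow> bool" where
  "superop_eigenvalue F c \<longleftrightarrow> (\<exists>X\<in>linear_ops. X \<noteq> 0 \<and> F X = op_scale c X)"

text \<open>
  The frame operator of a POVM is self-adjoint for the Hilbert--Schmidt inner product, so all its
  eigenvalues are real, and there are finitely many of them and at least one if the space is
  nontrivial.
\<close>

definition completeness_stability :: "'i set \<Rightarrow> ('i \<Rightarrow> 'h::fin_dim_complex_hilbert oper) \<Rightarrow> real" where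
  "completeness_stability I A = Min {r. superop_eigenvalue (scaled_frame I A) (complex_of_real r)}"

definition orthonormal_basis :: "nat \<Rightarrow> (nat \<Rightarrow> 'h::fin_dim_complex_hilbert) \<Rightarrow> bool" where
  "orthonormal_basis n e \<longleftrightarrow>
     (\<forall>a\<in>{1..n}. \<forall>b\<in>{1..n}. cinner (e a) (e b) = (if a = b then 1 else 0)) \<and>
     cvec.span (e ` {1..n}) = UNIV"

definition mutually_unbiased_bases :: "nat \<Rightarrow> (nat \<Rightarrow> nat \<Rightarrow> 'h::fin_dim_complex_hilbert) \<Rightarrow> bool" where
  "mutually_unbiased_bases k m \<longleftrightarrow>
     1 \<le> k \<and>
     (\<forall>j\<in>{1..k}. orthonormal_basis (dimC TYPE('h)) (m j)) \<and>
     (\<forall>j\<in>{1..k}. \<forall>l\<in>{1..k}. j \<noteq> l \<longrightarrow>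
        (\<forall>a\<in>{1..dimC TYPE('h)}. \<forall>b\<in>{1..dimC TYPE('h)}.
           (cmod (cinner (m j a) (m l b)))\<^sup>2 = 1 / real (dimC TYPE('h))))"

text \<open>The operator \<open>|u\<rangle>\<langle>u|\<close>.\<close>

definition rank_one :: "'h::fin_dim_complex_hilbert \<Rightarrow> 'h oper" where
  "rank_one u = (\<lambda>x. cinner u x *\<^sub>C u)"

definition mub_index :: "'h::fin_dim_complex_hilbert itself \<Rightarrow> nat \<Rightarrow> (nat \<times> nat) set" where
  "mub_index _ k = {1..k} \<times> {1..dimC TYPE('h)}"

definition mub_effect ::
    "nat \<Rightarrow> (nat \<Rightarrow> nat \<Rightarrow> 'h::fin_dim_complex_hilbert) \<Rightarrow> nat \<times> nat \<Rightarrow> 'h oper" where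
  "mub_effect k m = (\<lambda>(j, a). op_scale (1 / of_nat k) (rank_one (m j a)))"

end

theory Submission
  imports Defs "Jordan_Normal_Form.Schur_Decomposition"
begin

text \<open>
  In an orthonormal basis the frame operator of a POVM is a Hermitian \<open>d\<^sup>2 \<times> d\<^sup>2\<close> matrix of trace
  \<open>\<Sum>a. Tr (A\<^sub>a\<^sup>2) / Tr A\<^sub>a \<le> \<Sum>a. Tr A\<^sub>a = d\<close>. It fixes the identity operator, so one eigenvalue is 1, and
  the average of the remaining \<open>d\<^sup>2 - 1\<close> eigenvalues is at most \<open>(d - 1) / (d\<^sup>2 - 1) = 1 / (d + 1)\<close>.

  For \<open>k\<close> mutually unbiased bases with projectors \<open>P\<close>, unbiasedness says that the map
  \<open>Q X = (\<Sum>P. Tr (P X) P) + (1 - k) / d \<cdot> Tr X \<cdot> I\<close> fixes every \<open>P\<close>; hence it is the orthogonal projection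
  onto their span. Its trace is \<open>k (d - 1) + 1\<close>, which is less than \<open>d\<^sup>2\<close> for \<open>k < d + 1\<close> and equal to
  \<open>d\<^sup>2\<close> for \<open>k = d + 1\<close>. In the latter case \<open>Q\<close> is the identity, so that
  \<open>(d + 1) F X = X + Tr X \<cdot> I\<close>, and no eigenvalue of \<open>F\<close> is below \<open>1 / (d + 1)\<close>.
\<close>

subsection \<open>Spectra of finite kernels\<close>

text \<open>Keeps \<open>{1..d}\<close> from being rewritten to \<open>{Suc 0..d}\<close>.\<close>

declare One_nat_def [simp del]

text \<open>A matrix with rows and columns indexed by an arbitrary set \<open>S\<close>, so that
  operators can later be indexed by pairs; only the values of \<open>v\<close> on \<open>S\<close>
  matter.\<close>

definition kernel_eigenvalue :: "'p set \<Rightarrow> ('p \<Rightarrow> 'p \<Rightarrow> complex) \<Rightarrow> complex \<Rightarrow> bool" where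
  "kernel_eigenvalue S M c \<longleftrightarrow>
     (\<exists>v. (\<exists>p\<in>S. v p \<noteq> 0) \<and> (\<forall>p\<in>S. (\<Sum>q\<in>S. M p q * v q) = c * v p))"

text \<open>Enumerating \<open>S\<close> by \<open>h\<close> turns the kernel into a square matrix,
  and eigenvectors correspond through \<open>w (h i) = v $ i\<close>. This makes the spectral theory
  of matrices available.\<close>

lemma eigenvalue_mat_iff_kernel_eigenvalue:
  assumes h: "bij_betw h {0..<n} S"
  shows "eigenvalue (mat n n (\<lambda>(i, j). M (h i) (h j))) c \<longleftrightarrow> kernel_eigenvalue S M c"
    (is "eigenvalue ?A c \<longleftrightarrow> _")
proof
  have reindex: "(\<Sum>q\<in>S. f q) = (\<Sum>j<n. f (h j))" for f :: "'a \<Rightarrow> complex"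
    using sum.reindex_bij_betw[OF h, of f] by (simp add: atLeast0LessThan)
  have S: "S = h ` {0..<n}" using h by (simp add: bij_betw_def)
  {
    assume "eigenvalue ?A c"
    then obtain v where v: "v \<in> carrier_vec n" "v \<noteq> 0\<^sub>v n" "?A *\<^sub>v v = c \<cdot>\<^sub>v v"
      by (auto simp: eigenvalue_def eigenvector_def)
    define w where "w p = v $ (inv_into {0..<n} h p)" for p
    have w: "w (h i) = v $ i" if "i < n" for i
      using that h by (simp add: w_def bij_betw_def inv_into_f_f)
    have "\<exists>i<n. v $ i \<noteq> 0" using v(1,2) by (metis carrier_vecD eq_vecI index_zero_vec)
    then have "\<exists>p\<in>S. w p \<noteq> 0" using w by (auto simp: S)
    moreover have "(\<Sum>q\<in>S. M p q * w q) = c * w p" if p: "p \<in> S" for p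
    proof -
      obtain i where i: "i < n" "p = h i" using p S by auto
      have "(?A *\<^sub>v v) $ i = c * v $ i" using v i by simp
      moreover have "(?A *\<^sub>v v) $ i = (\<Sum>j<n. M (h i) (h j) * v $ j)"
        using v(1) i by (simp add: mult_mat_vec_def scalar_prod_def atLeast0LessThan)
      ultimately show ?thesis using i by (simp add: reindex w)
    qed
    ultimately show "kernel_eigenvalue S M c" by (auto simp: kernel_eigenvalue_def)
  next
    assume "kernel_eigenvalue S M c"
    then obtain w where w: "\<exists>p\<in>S. w p \<noteq> 0" "\<And>p. p \<in> S \<Longrightarrow> (\<Sum>q\<in>S. M p q * w q) = c * w p"
      by (auto simp: kernel_eigenvalue_def)
    define v where "v = vec n (\<lambda>i. w (h i))"
    have "v \<noteq> 0\<^sub>v n"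
    proof
      assume "v = 0\<^sub>v n"
      then have "w (h i) = 0" if "i < n" for i using that by (metis v_def index_vec index_zero_vec(1))
      then show False using w(1) by (auto simp: S)
    qed
    moreover have "?A *\<^sub>v v = c \<cdot>\<^sub>v v"
    proof (rule eq_vecI)
      fix i assume "i < dim_vec (c \<cdot>\<^sub>v v)"
      then have i: "i < n" by (simp add: v_def)
      then have "(?A *\<^sub>v v) $ i = (\<Sum>j<n. M (h i) (h j) * w (h j))"
        by (simp add: mult_mat_vec_def scalar_prod_def atLeast0LessThan v_def)
      also have "\<dots> = c * w (h i)" using w(2)[of "h i"] i bij_betwE[OF h] by (simp add: reindex)
      finally show "(?A *\<^sub>v v) $ i = (c \<cdot>\<^sub>v v) $ i" using i by (simp add: v_def)
    qed (simp add: v_def)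
    ultimately show "eigenvalue ?A c"
      by (auto simp: eigenvalue_def eigenvector_def v_def intro!: exI[of _ v])
  }
qed

text \<open>Cyclicity of the trace moves \<open>Q\<close> to the front of \<open>P * B * Q\<close>,
  where \<open>Q * P\<close> is the unit matrix.\<close>

lemma trace_similar_mat:
  fixes A :: "'a::comm_ring_1 mat"
  assumes A: "A \<in> carrier_mat n n" and sim: "similar_mat_wit A B P Q"
  shows "(\<Sum>i<n. A $$ (i, i)) = (\<Sum>i<n. B $$ (i, i))"
proof -
  from similar_mat_witD2[OF A sim]
  have B: "B \<in> carrier_mat n n" and P: "P \<in> carrier_mat n n" and Q: "Q \<in> carrier_mat n n"
    and QP: "Q * P = 1\<^sub>m n" and APBQ: "A = P * B * Q" by auto
  have tr: "(\<Sum>i<n. (X * Y) $$ (i, i)) = (\<Sum>i<n. (Y * X) $$ (i, i))"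
    if "X \<in> carrier_mat n n" "Y \<in> carrier_mat n n" for X Y :: "'a mat"
  proof -
    have "(\<Sum>i<n. (X * Y) $$ (i, i)) = (\<Sum>i<n. \<Sum>j<n. X $$ (i, j) * Y $$ (j, i))"
      using that by (simp add: scalar_prod_def atLeast0LessThan)
    also have "\<dots> = (\<Sum>i<n. \<Sum>j<n. Y $$ (i, j) * X $$ (j, i))"
      by (subst sum.swap) (simp add: mult.commute)
    also have "\<dots> = (\<Sum>i<n. (Y * X) $$ (i, i))"
      using that by (simp add: scalar_prod_def atLeast0LessThan)
    finally show ?thesis .
  qed
  have "(\<Sum>i<n. A $$ (i, i)) = (\<Sum>i<n. (Q * (P * B)) $$ (i, i))"
    using tr[of "P * B" Q] P B Q APBQ by simp
  also have "Q * (P * B) = B"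
    using P B Q QP by (simp add: assoc_mult_mat[symmetric, OF Q P B])
  finally show ?thesis .
qed

text \<open>A Schur decomposition is similar to the matrix and carries the roots \<open>es\<close>
  of the characteristic polynomial, with multiplicity, on its diagonal. Similarity preserves the
  trace, so the eigenvalues add up to it.\<close>

lemma kernel_spectrum:
  assumes S: "finite S"
  obtains es where "length es = card S" "sum_list es = (\<Sum>p\<in>S. M p p)"
    "\<And>c. kernel_eigenvalue S M c \<longleftrightarrow> c \<in> set es"
proof -
  define n where "n = card S"
  obtain h where h: "bij_betw h {0..<n} S"
    using ex_bij_betw_nat_finite[OF S] by (auto simp: n_def)
  define A where "A = mat n n (\<lambda>(i, j). M (h i) (h j))"
  have A: "A \<in> carrier_mat n n" by (simp add: A_def)
  obtain es where es: "char_poly A = (\<Prod>a\<leftarrow>es. [:- a, 1:])" "length es = n"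
    using char_poly_factorized[OF A] by blast
  obtain B P Q where schur: "schur_decomposition A es = (B, P, Q)"
    by (cases "schur_decomposition A es") auto
  from schur_decomposition[OF A es(1) schur]
  have sim: "similar_mat_wit A B P Q" and diag: "diag_mat B = es" by auto
  have B: "B \<in> carrier_mat n n" using similar_mat_witD2[OF A sim] by auto
  have "sum_list es = (\<Sum>i<n. B $$ (i, i))"
    using B unfolding diag[symmetric] diag_mat_def
    by (simp add: sum_list_sum_nth atLeast0LessThan)
  also have "\<dots> = (\<Sum>i<n. A $$ (i, i))" using trace_similar_mat[OF A sim] by simp
  also have "\<dots> = (\<Sum>p\<in>S. M p p)"
    using sum.reindex_bij_betw[OF h, of "\<lambda>p. M p p"] by (simp add: A_def atLeast0LessThan)
  finally have "sum_list es = (\<Sum>p\<in>S. M p p)" .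
  moreover have "kernel_eigenvalue S M c \<longleftrightarrow> c \<in> set es" for c
    using eigenvalue_mat_iff_kernel_eigenvalue[OF h, of M c] eigenvalue_root_char_poly[OF A, of c]
    by (auto simp: A_def[symmetric] es(1) poly_prod_list prod_list_zero_iff)
  ultimately show thesis using that[of es] es(2) by (simp add: n_def)
qed

text \<open>The quadratic form \<open>z\<close> of the kernel at an eigenvector is \<open>c\<close>
  times its squared norm \<open>N > 0\<close>, and the Hermitian symmetry makes \<open>z\<close>
  real.\<close>

lemma hermitian_kernel_eigenvalue_real:
  assumes S: "finite S" and herm: "\<And>p q. p \<in> S \<Longrightarrow> q \<in> S \<Longrightarrow> cnj (M p q) = M q p"
    and ev: "kernel_eigenvalue S M c"
  shows "c = complex_of_real (Re c)"
proof -
  obtain v where v: "\<exists>p\<in>S. v p \<noteq> 0" "\<And>p. p \<in> S \<Longrightarrow> (\<Sum>q\<in>S. M p q * v q) = c * v p"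
    using ev by (auto simp: kernel_eigenvalue_def)
  define N where "N = (\<Sum>p\<in>S. (cmod (v p))\<^sup>2)"
  have "N > 0" using v(1) S by (auto simp: N_def intro!: sum_pos2)
  define z where "z = (\<Sum>p\<in>S. \<Sum>q\<in>S. cnj (v p) * M p q * v q)"
  have "z = (\<Sum>p\<in>S. cnj (v p) * (c * v p))"
    by (simp add: z_def v(2)[symmetric] sum_distrib_left mult.assoc)
  also have "\<dots> = c * of_real N"
    by (simp add: N_def sum_distrib_left complex_norm_square mult_ac del: of_real_power)
  finally have z: "z = c * of_real N" .
  have "cnj z = (\<Sum>p\<in>S. \<Sum>q\<in>S. cnj (v q) * M q p * v p)"
    by (simp add: z_def herm mult_ac cong: sum.cong)
  also have "\<dots> = z" unfolding z_def by (rule sum.swap)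
  finally have "cnj c = c" using z \<open>N > 0\<close> by simp
  then show ?thesis by (simp add: complex_eq_iff)
qed

text \<open>The witness is the smallest eigenvalue: the trace is the sum of \<open>card S\<close>
  real eigenvalues, one of them is 1, and each of the others is at least \<open>r\<close>.\<close>

lemma hermitian_kernel_min_eigenvalue:
  assumes S: "finite S" and herm: "\<And>p q. p \<in> S \<Longrightarrow> q \<in> S \<Longrightarrow> cnj (M p q) = M q p"
    and one: "kernel_eigenvalue S M 1"
  shows "\<exists>r. kernel_eigenvalue S M (complex_of_real r) \<and>
           1 + (real (card S) - 1) * r \<le> Re (\<Sum>p\<in>S. M p p)"
proof -
  obtain es where es: "length es = card S" "sum_list es = (\<Sum>p\<in>S. M p p)"
    "\<And>c. kernel_eigenvalue S M c \<longleftrightarrow> c \<in> set es"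
    using kernel_spectrum[OF S] by metis
  have 1: "1 \<in> set es" using one es(3) by simp
  define r where "r = Min (Re ` set es)"
  have "r \<in> Re ` set es" unfolding r_def using 1 by (intro Min_in) auto
  then obtain c where c: "c \<in> set es" "r = Re c" by blast
  then have "kernel_eigenvalue S M (complex_of_real r)"
    using es(3)[of c] hermitian_kernel_eigenvalue_real[of S M c, OF S herm] by simp
  moreover have le: "r \<le> Re c" if "c \<in> set es" for c
    using that by (simp add: r_def)
  have bound: "real (length xs) * r \<le> Re (sum_list xs)" if "set xs \<subseteq> set es" for xs
    using that by (induction xs) (auto simp: algebra_simps dest!: le)
  have "1 + (real (card S) - 1) * r \<le> Re (sum_list es)"
  proof -
    \<comment> \<open>Only one occurrence of the eigenvalue 1 is split off, which leaves
      \<open>card S - 1\<close> entries for \<open>bound\<close> even if 1 has higher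
      multiplicity.\<close>
    have "Re (sum_list es) = 1 + Re (sum_list (remove1 1 es))"
      using sum_list_map_remove1[OF 1, of "\<lambda>x. x"] by simp
    moreover have "real (length (remove1 1 es)) = real (card S) - 1"
      using 1 es(1) length_pos_if_in_set[OF 1] by (simp add: length_remove1 of_nat_diff Suc_leI)
    ultimately show ?thesis using bound[of "remove1 1 es"] by (simp add: set_remove1_subset)
  qed
  ultimately show "\<exists>r. kernel_eigenvalue S M (complex_of_real r) \<and>
      1 + (real (card S) - 1) * r \<le> Re (\<Sum>p\<in>S. M p p)"
    using es(2) by metis
qed

subsection \<open>Operators in an orthonormal basis\<close>

lemma cinner_add_left: "cinner (x + y) z = cinner x z + cinner y (z::'h::fin_dim_complex_hilbert)"
  by (subst (1 2 3) cinner_commute) (simp add: cinner_add_right)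

lemma cinner_scaleC_left: "cinner (c *\<^sub>C x) (y::'h::fin_dim_complex_hilbert) = cnj c * cinner x y"
  by (subst (1 2) cinner_commute) (simp add: cinner_scaleC_right)

lemma cinner_zero_right [simp]: "cinner x (0::'h::fin_dim_complex_hilbert) = 0"
  using cinner_add_right[of x 0 0] by simp

lemma cinner_diff_right:
  "cinner x (y - z) = cinner x y - cinner x (z::'h::fin_dim_complex_hilbert)"
  using cinner_add_right[of x "y - z" z] by simp

lemma cinner_sum_right:
  "cinner x (\<Sum>i\<in>I. f i) = (\<Sum>i\<in>I. cinner x (f i :: 'h::fin_dim_complex_hilbert))"
  by (induction I rule: infinite_finite_induct) (simp_all add: cinner_add_right)

lemma sum_fun_apply: "(\<Sum>i\<in>I. f i) x = (\<Sum>i\<in>I. f i x)"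
  for f :: "'i \<Rightarrow> 'b \<Rightarrow> 'c::comm_monoid_add"
  by (induction I rule: infinite_finite_induct) auto

lemma linear_opsD:
  assumes "A \<in> linear_ops"
  shows "A (x + y) = A x + A y" "A (c *\<^sub>C x) = c *\<^sub>C A x" "A (\<Sum>i\<in>I. f i) = (\<Sum>i\<in>I. A (f i))"
proof -
  interpret Vector_Spaces.linear scaleC scaleC A using assms by (simp add: linear_ops_def)
  show "A (x + y) = A x + A y" "A (c *\<^sub>C x) = c *\<^sub>C A x" "A (\<Sum>i\<in>I. f i) = (\<Sum>i\<in>I. A (f i))"
    by (simp_all add: add scale sum)
qed

lemma linear_opsI:
  assumes "\<And>x y. A (x + y) = A x + A y" "\<And>c x. A (c *\<^sub>C x) = c *\<^sub>C A x"
  shows "A \<in> linear_ops"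
  unfolding linear_ops_def using assms
  by (auto intro!: Vector_Spaces.linear.intro module_hom.intro module_hom_axioms.intro
      cvec.vector_space_axioms cvec.module_axioms)

lemma subspace_linear_ops: "cop.subspace (linear_ops :: 'h::fin_dim_complex_hilbert oper set)"
  unfolding cop.subspace_def
  by (auto intro!: linear_opsI simp: linear_opsD op_scale_def cvec.scale_right_distrib mult.commute)

lemma linear_ops_id: "id \<in> linear_ops"
  by (intro linear_opsI) auto

lemma linear_ops_rank_one: "rank_one u \<in> linear_ops"
  by (intro linear_opsI)
    (auto simp: rank_one_def cinner_add_right cinner_scaleC_right cvec.scale_left_distrib)

lemma linear_ops_scaled_frame:
  assumes "\<And>a. a \<in> I \<Longrightarrow> A a \<in> linear_ops"
  shows "scaled_frame I A X \<in> linear_ops"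
  unfolding scaled_frame_def
  using assms by (intro cop.subspace_sum cop.subspace_scale subspace_linear_ops)

section \<open>Positive semidefinite operators\<close>

lemma pos_semidef_linear: "pos_semidef A \<Longrightarrow> A \<in> linear_ops"
  by (simp add: pos_semidef_def)

lemma pos_semidef_diag:
  assumes "pos_semidef A"
  shows "cinner x (A x) = of_real (Re (cinner x (A x)))" "0 \<le> Re (cinner x (A x))"
  using assms by (auto simp: pos_semidef_def complex_eq_iff)

text \<open>Polarization: reality of the quadratic form at \<open>x + y\<close> compares the
  imaginary parts of the two sides, reality at \<open>x + \<i> *\<^sub>C y\<close> the real
  parts.\<close>

lemma pos_semidef_hermitian:
  assumes A: "pos_semidef A"
  shows "cnj (cinner x (A y)) = cinner y (A x)"
proof -
  note lin = linear_opsD[OF pos_semidef_linear[OF A]]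
  have im: "Im (cinner z (A z)) = 0" for z using A by (simp add: pos_semidef_def)
  have "Im (cinner x (A y) + cinner y (A x)) = 0"
    using im[of "x + y"] im[of x] im[of y] by (simp add: lin cinner_add_left cinner_add_right)
  moreover have "Im (\<i> * cinner x (A y) - \<i> * cinner y (A x)) = 0"
    using im[of "x + \<i> *\<^sub>C y"] im[of x] im[of y]
    by (simp add: lin cinner_add_left cinner_add_right cinner_scaleC_left cinner_scaleC_right)
  ultimately show ?thesis by (simp add: complex_eq_iff)
qed

text \<open>Choosing \<open>t = - s * cnj b\<close> with real \<open>s\<close> aligns the phase of
  \<open>t * b\<close> and leaves a real polynomial in \<open>s\<close>, to which the usual
  discriminant argument applies.\<close>

lemma discriminant_bound:
  fixes b :: complex
  assumes nonneg: "\<And>t. 0 \<le> a + 2 * Re (t * b) + (cmod t)\<^sup>2 * c" and a: "0 \<le> a" and c: "0 \<le> c"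
  shows "(cmod b)\<^sup>2 \<le> a * c"
proof -
  have *: "0 \<le> a - 2 * s * (cmod b)\<^sup>2 + s\<^sup>2 * (cmod b)\<^sup>2 * c" for s :: real
  proof -
    have "Re (of_real (- s) * cnj b * b) = - s * (cmod b)\<^sup>2"
      unfolding cmod_power2 by (simp add: power2_eq_square algebra_simps)
    moreover have "(cmod (of_real (- s) * cnj b))\<^sup>2 = s\<^sup>2 * (cmod b)\<^sup>2"
      by (simp add: norm_mult power_mult_distrib)
    ultimately show ?thesis
      using nonneg[of "of_real (- s) * cnj b"] by (simp only:)
  qed
  show ?thesis
  proof (cases "c = 0")
    case True
    have "b = 0"
    proof (rule ccontr)
      assume "b \<noteq> 0"
      \<comment> \<open>For \<open>c = 0\<close> the polynomial is affine in \<open>s\<close>; this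
        \<open>s\<close> gives it the negative value \<open>- a - 2\<close>.\<close>
      then have "(a + 1) / (cmod b)\<^sup>2 * (cmod b)\<^sup>2 = a + 1" by simp
      then show False
        using *[of "(a + 1) / (cmod b)\<^sup>2"] True a \<open>b \<noteq> 0\<close> by (simp add: mult.assoc)
    qed
    then show ?thesis using True by simp
  next
    case False
    then have "c > 0" using c by simp
    moreover have "(1 / c)\<^sup>2 * (cmod b)\<^sup>2 * c = (cmod b)\<^sup>2 / c"
      using \<open>c > 0\<close> by (simp add: power2_eq_square)
    \<comment> \<open>For \<open>c > 0\<close> the polynomial is smallest at
      \<open>s = 1 / c\<close>.\<close>
    ultimately have "(cmod b)\<^sup>2 / c \<le> a" using *[of "1 / c"] by simp
    then show ?thesis using \<open>c > 0\<close> by (simp add: pos_divide_le_eq)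
  qed
qed

text \<open>The form of \<open>A\<close> is nonnegative at \<open>x + t *\<^sub>C y\<close> for
  every complex \<open>t\<close>. Applied to basis vectors, this bounds each matrix entry by two
  diagonal entries.\<close>

lemma pos_semidef_cauchy_schwarz:
  assumes A: "pos_semidef A"
  shows "(cmod (cinner x (A y)))\<^sup>2 \<le> Re (cinner x (A x)) * Re (cinner y (A y))"
proof (rule discriminant_bound)
  note lin = linear_opsD[OF pos_semidef_linear[OF A]]
  fix t
  have "Re (cinner (x + t *\<^sub>C y) (A (x + t *\<^sub>C y))) =
      Re (cinner x (A x)) + 2 * Re (t * cinner x (A y)) + (cmod t)\<^sup>2 * Re (cinner y (A y))"
    using pos_semidef_hermitian[OF A, of x y, symmetric] pos_semidef_diag(1)[OF A, of y]
    unfolding cmod_power2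
    by (simp add: lin cinner_add_left cinner_add_right cinner_scaleC_left cinner_scaleC_right
        complex_eq_iff algebra_simps power2_eq_square)
  then show "0 \<le> Re (cinner x (A x)) + 2 * Re (t * cinner x (A y)) + (cmod t)\<^sup>2 * Re (cinner y (A y))"
    using pos_semidef_diag(2)[OF A] by metis
qed (use pos_semidef_diag[OF A] in auto)

lemma cinner_rank_one: "cinner x (rank_one u x) = of_real ((cmod (cinner x u))\<^sup>2)"
  by (simp add: rank_one_def cinner_scaleC_right complex_norm_square cinner_commute[of u x]
      mult.commute del: of_real_power)

lemma pos_semidef_rank_one: "pos_semidef (rank_one u)"
  by (simp add: pos_semidef_def linear_ops_rank_one cinner_rank_one del: of_real_power)

section \<open>Matrix entries and the trace in an orthonormal basis\<close>

locale orthonormal =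
  fixes d :: nat and e :: "nat \<Rightarrow> 'h::fin_dim_complex_hilbert"
  assumes onb: "orthonormal_basis d e"
begin

definition entry :: "'h oper \<Rightarrow> nat \<times> nat \<Rightarrow> complex" where
  "entry X = (\<lambda>(i, j). cinner (e i) (X (e j)))"

abbreviation idx :: "(nat \<times> nat) set" where "idx \<equiv> {1..d} \<times> {1..d}"

text \<open>The matrix unit \<open>|e i><e j|\<close>.\<close>

definition unit_op :: "nat \<times> nat \<Rightarrow> 'h oper" where
  "unit_op = (\<lambda>(i, j) x. cinner (e j) x *\<^sub>C e i)"

lemma cinner_basis: "i \<in> {1..d} \<Longrightarrow> j \<in> {1..d} \<Longrightarrow> cinner (e i) (e j) = (if i = j then 1 else 0)"
  using onb by (simp add: orthonormal_basis_def)

lemma span_basis: "cvec.span (e ` {1..d}) = UNIV"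
  using onb by (simp add: orthonormal_basis_def)

lemma inj_basis: "inj_on e {1..d}"
  by (rule inj_onI) (metis cinner_basis one_neq_zero)

lemma basis_expansion: "x = (\<Sum>i\<in>{1..d}. cinner (e i) x *\<^sub>C e i)"
proof -
  have "x \<in> cvec.span (e ` {1..d})" using span_basis by simp
  then show ?thesis
  proof (induction rule: cvec.span_induct_alt)
    case base
    then show ?case by simp
  next
    case (step c b y)
    then obtain j where j: "j \<in> {1..d}" "b = e j" by auto
    have "(\<Sum>i\<in>{1..d}. cinner (e i) b *\<^sub>C e i) = (\<Sum>i\<in>{1..d}. if i = j then e i else 0)"
      using j cinner_basis by (intro sum.cong) auto
    then have b: "b = (\<Sum>i\<in>{1..d}. cinner (e i) b *\<^sub>C e i)" using j by simp
    have "(\<Sum>i\<in>{1..d}. cinner (e i) (c *\<^sub>C b + y) *\<^sub>C e i) =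
        c *\<^sub>C (\<Sum>i\<in>{1..d}. cinner (e i) b *\<^sub>C e i) + (\<Sum>i\<in>{1..d}. cinner (e i) y *\<^sub>C e i)"
      by (simp add: cinner_add_right cinner_scaleC_right scaleC_add_left sum.distrib
          cvec.scale_sum_right)
    then show ?case using b step.IH by simp
  qed
qed

lemma parseval: "cinner x y = (\<Sum>i\<in>{1..d}. cinner x (e i) * cinner (e i) y)"
proof -
  have "cinner x y = cinner x (\<Sum>i\<in>{1..d}. cinner (e i) y *\<^sub>C e i)"
    by (simp only: basis_expansion[symmetric])
  then show ?thesis by (simp add: cinner_sum_right cinner_scaleC_right mult.commute)
qed

lemma linear_op_eqI:
  assumes A: "A \<in> linear_ops" and B: "B \<in> linear_ops"
    and eq: "\<And>p. p \<in> idx \<Longrightarrow> entry A p = entry B p"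
  shows "A = B"
proof
  fix x
  have basis: "A (e j) = B (e j)" if "j \<in> {1..d}" for j
  proof -
    have "(\<Sum>i\<in>{1..d}. cinner (e i) (A (e j)) *\<^sub>C e i) = (\<Sum>i\<in>{1..d}. cinner (e i) (B (e j)) *\<^sub>C e i)"
      using eq[of "(_, j)"] that by (intro sum.cong) (auto simp: entry_def)
    then show ?thesis by (simp only: basis_expansion[symmetric])
  qed
  have expand: "C x = (\<Sum>j\<in>{1..d}. cinner (e j) x *\<^sub>C C (e j))" if "C \<in> linear_ops" for C
  proof -
    have "C x = C (\<Sum>j\<in>{1..d}. cinner (e j) x *\<^sub>C e j)" by (simp only: basis_expansion[symmetric])
    then show ?thesis by (simp only: linear_opsD[OF that])
  qed
  show "A x = B x"
    using basis unfolding expand[OF A] expand[OF B] by (intro sum.cong) auto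
qed

lemma independent_basis: "cvec.independent (e ` {1..d})"
proof (rule cvec.independent_if_scalars_zero)
  fix f x
  assume sum: "(\<Sum>x\<in>e ` {1..d}. f x *\<^sub>C x) = 0" and "x \<in> e ` {1..d}"
  then obtain j where j: "j \<in> {1..d}" "x = e j" by auto
  have "0 = cinner (e j) (\<Sum>i\<in>{1..d}. f (e i) *\<^sub>C e i)"
    using sum unfolding sum.reindex[OF inj_basis] by simp
  also have "\<dots> = (\<Sum>i\<in>{1..d}. if i = j then f (e i) else 0)"
    using j(1) unfolding cinner_sum_right cinner_scaleC_right
    by (intro sum.cong) (auto simp: cinner_basis)
  also have "\<dots> = f x" using j by simp
  finally show "f x = 0" by simp
qed simp

text \<open>By \<open>op_trace_eq\<close> the trace may be computed in the basis \<open>e\<close>,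
  where orthonormality turns the coefficient at \<open>e j\<close> into an inner product.\<close>

lemma op_trace_basis:
  assumes "A \<in> linear_ops"
  shows "op_trace A = (\<Sum>i\<in>{1..d}. cinner (e i) (A (e i)))"
proof -
  let ?B = "e ` {1..d}"
  have repr: "cvec.representation ?B x (e j) = cinner (e j) x" if j: "j \<in> {1..d}" for x j
  proof -
    let ?r = "cvec.representation ?B x"
    have "x = (\<Sum>b\<in>?B. ?r b *\<^sub>C b)"
      using cvec.sum_representation_eq[OF independent_basis, of x ?B] span_basis by simp
    then have "cinner (e j) x = cinner (e j) (\<Sum>i\<in>{1..d}. ?r (e i) *\<^sub>C e i)"
      unfolding sum.reindex[OF inj_basis] by simp
    also have "\<dots> = (\<Sum>i\<in>{1..d}. if i = j then ?r (e i) else 0)"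
      using j unfolding cinner_sum_right cinner_scaleC_right
      by (intro sum.cong) (auto simp: cinner_basis)
    also have "\<dots> = ?r (e j)" using j by simp
    finally show ?thesis by simp
  qed
  show ?thesis
    unfolding op_trace_eq[OF assms independent_basis span_basis] sum.reindex[OF inj_basis]
    by (simp add: repr)
qed

lemma op_trace_add:
  fixes A B :: "'h oper"
  assumes "A \<in> linear_ops" "B \<in> linear_ops"
  shows "op_trace (A + B) = op_trace A + op_trace B"
  using assms cop.subspace_add[OF subspace_linear_ops assms]
  by (simp add: op_trace_basis cinner_add_right sum.distrib)

lemma op_trace_scale:
  fixes A :: "'h oper"
  assumes "A \<in> linear_ops"
  shows "op_trace (op_scale c A) = c * op_trace A"
  unfolding op_trace_basis[OF assms] op_trace_basis[OF cop.subspace_scale[OF subspace_linear_ops assms]]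
  by (simp add: op_scale_def cinner_scaleC_right sum_distrib_left)

lemma op_trace_sum:
  fixes A :: "'i \<Rightarrow> 'h oper"
  assumes "\<And>a. a \<in> I \<Longrightarrow> A a \<in> linear_ops"
  shows "op_trace (\<Sum>a\<in>I. A a) = (\<Sum>a\<in>I. op_trace (A a))"
proof -
  have "op_trace (\<Sum>a\<in>I. A a) = (\<Sum>i\<in>{1..d}. \<Sum>a\<in>I. cinner (e i) (A a (e i)))"
    using cop.subspace_sum[OF subspace_linear_ops, of I A] assms
    by (simp add: op_trace_basis sum_fun_apply cinner_sum_right)
  also have "\<dots> = (\<Sum>a\<in>I. op_trace (A a))"
    using assms by (subst sum.swap) (simp add: op_trace_basis)
  finally show ?thesis .
qed

lemma op_trace_id: "op_trace (id :: 'h oper) = of_nat d"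
  by (simp add: op_trace_basis[OF linear_ops_id] cinner_basis)

lemma linear_ops_unit_op: "unit_op p \<in> linear_ops"
  by (cases p) (auto intro!: linear_opsI simp: unit_op_def cinner_add_right cinner_scaleC_right
      cvec.scale_left_distrib)

lemma entry_unit_op: "p \<in> idx \<Longrightarrow> q \<in> idx \<Longrightarrow> entry (unit_op p) q = (if p = q then 1 else 0)"
  by (cases p; cases q) (auto simp: unit_op_def entry_def cinner_scaleC_right cinner_basis)

lemma entry_add: "entry (A + B) p = entry A p + entry B p"
  and entry_diff: "entry (A - B) p = entry A p - entry B p"
  and entry_scale: "entry (op_scale c A) p = c * entry A p"
  and entry_zero: "entry 0 p = 0"
  and entry_sum: "entry (\<Sum>a\<in>I. f a) p = (\<Sum>a\<in>I. entry (f a) p)"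
  by (cases p; simp add: entry_def op_scale_def cinner_add_right cinner_diff_right
      cinner_scaleC_right cinner_sum_right sum_fun_apply)+

lemma entry_id: "p \<in> idx \<Longrightarrow> entry id p = (if fst p = snd p then 1 else 0)"
  by (cases p) (auto simp: entry_def cinner_basis)

lemma entry_rank_one: "entry (rank_one u) p = cinner (e (fst p)) u * cinner u (e (snd p))"
  by (cases p) (simp add: entry_def rank_one_def cinner_scaleC_right mult.commute)

text \<open>Since the matrix units span the operators, membership in a subspace need only be checked
  on them.\<close>

lemma op_eq_sum_unit_ops:
  assumes "X \<in> linear_ops"
  shows "X = (\<Sum>p\<in>idx. op_scale (entry X p) (unit_op p))"
proof (rule linear_op_eqI[OF assms])
  show "(\<Sum>p\<in>idx. op_scale (entry X p) (unit_op p)) \<in> linear_ops"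
    by (intro cop.subspace_sum cop.subspace_scale subspace_linear_ops linear_ops_unit_op)
  fix q assume q: "q \<in> idx"
  have "entry (\<Sum>p\<in>idx. op_scale (entry X p) (unit_op p)) q = (\<Sum>p\<in>idx. if p = q then entry X p else 0)"
    unfolding entry_sum entry_scale using q by (intro sum.cong) (auto simp: entry_unit_op)
  also have "\<dots> = entry X q" using q by simp
  finally show "entry X q = entry (\<Sum>p\<in>idx. op_scale (entry X p) (unit_op p)) q" by simp
qed

text \<open>Self-adjointness of \<open>A\<close> replaces its transposed entries by conjugates. The
  coefficients in \<open>scaled_frame\<close> thereby become linear expressions in the entries of
  \<open>X\<close>.\<close>

lemma op_trace_comp:
  assumes A: "pos_semidef A" and X: "X \<in> linear_ops"
  shows "op_trace (A \<circ> X) = (\<Sum>p\<in>idx. cnj (entry A p) * entry X p)"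
proof -
  note linA = linear_opsD[OF pos_semidef_linear[OF A]]
  have "A \<circ> X \<in> linear_ops" by (intro linear_opsI) (simp_all add: linA linear_opsD[OF X])
  then have "op_trace (A \<circ> X) = (\<Sum>j\<in>{1..d}. cinner (e j) (A (X (e j))))"
    by (simp add: op_trace_basis)
  also have "\<dots> = (\<Sum>j\<in>{1..d}. \<Sum>i\<in>{1..d}. cnj (entry A (i, j)) * entry X (i, j))"
  proof (intro sum.cong refl)
    fix j
    have "cinner (e j) (A (X (e j))) = cinner (e j) (A (\<Sum>i\<in>{1..d}. cinner (e i) (X (e j)) *\<^sub>C e i))"
      by (simp only: basis_expansion[symmetric])
    then show "cinner (e j) (A (X (e j))) = (\<Sum>i\<in>{1..d}. cnj (entry A (i, j)) * entry X (i, j))"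
      by (simp add: linA cinner_sum_right cinner_scaleC_right entry_def pos_semidef_hermitian[OF A]
          mult.commute)
  qed
  also have "\<dots> = (\<Sum>p\<in>idx. cnj (entry A p) * entry X p)"
    by (subst sum.swap) (simp add: sum.cartesian_product)
  finally show ?thesis .
qed

lemma op_trace_rank_one_comp:
  fixes X :: "'h oper"
  assumes X: "X \<in> linear_ops"
  shows "op_trace (rank_one u \<circ> X) = cinner u (X u)"
proof -
  note lin = linear_opsD[OF X]
  have "rank_one u \<circ> X \<in> linear_ops"
    by (intro linear_opsI) (simp_all add: lin linear_opsD[OF linear_ops_rank_one])
  then have "op_trace (rank_one u \<circ> X) = (\<Sum>i\<in>{1..d}. cinner u (X (e i)) * cinner (e i) u)"
    by (simp add: op_trace_basis rank_one_def cinner_scaleC_right)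
  also have "\<dots> = cinner u (X (\<Sum>i\<in>{1..d}. cinner (e i) u *\<^sub>C e i))"
    by (simp add: lin cinner_sum_right cinner_scaleC_right mult.commute)
  finally show ?thesis by (simp only: basis_expansion[symmetric])
qed

end

subsection \<open>The scaled frame operator\<close>

context orthonormal
begin

text \<open>The Hilbert-Schmidt inner product, written with entries so that no adjoint has to be
  formed; for positive semidefinite \<open>X\<close> and linear \<open>Y\<close> it is the trace of
  \<open>X \<circ> Y\<close> by \<open>op_trace_comp\<close>.\<close>

definition hs :: "'h oper \<Rightarrow> 'h oper \<Rightarrow> complex" where
  "hs X Y = (\<Sum>p\<in>idx. cnj (entry X p) * entry Y p)"

lemma hs_commute: "hs X Y = cnj (hs Y X)"
  by (simp add: hs_def mult.commute)

lemma hs_self: "hs X X = of_real (\<Sum>p\<in>idx. (cmod (entry X p))\<^sup>2)"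
  by (simp add: hs_def complex_norm_square mult.commute del: of_real_power)

lemma hs_add_right: "hs X (Y + Z) = hs X Y + hs X Z"
  and hs_diff_right: "hs X (Y - Z) = hs X Y - hs X Z"
  and hs_diff_left: "hs (Y - Z) X = hs Y X - hs Z X"
  and hs_scale_right: "hs X (op_scale c Y) = c * hs X Y"
  by (simp_all add: hs_def entry_add entry_diff entry_scale sum.distrib sum_subtractf
      sum_distrib_left algebra_simps)

lemma hs_sum_right: "hs X (\<Sum>a\<in>I. f a) = (\<Sum>a\<in>I. hs X (f a))"
  unfolding hs_def entry_sum sum_distrib_left by (rule sum.swap)

lemma hs_unit_op: "p \<in> idx \<Longrightarrow> hs (unit_op p) X = entry X p"
proof -
  assume p: "p \<in> idx"
  then have "hs (unit_op p) X = (\<Sum>q\<in>idx. if q = p then entry X q else 0)"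
    unfolding hs_def by (intro sum.cong) (auto simp: entry_unit_op)
  then show ?thesis using p by simp
qed

lemma hs_self_eq_0:
  assumes "X \<in> linear_ops" "hs X X = 0"
  shows "X = 0"
proof (rule linear_op_eqI)
  have "(\<Sum>p\<in>idx. (cmod (entry X p))\<^sup>2) = 0" using assms(2) unfolding hs_self by (simp only: of_real_eq_0_iff)
  then show "entry X p = entry 0 p" if "p \<in> idx" for p
    using that by (subst (asm) sum_nonneg_eq_0_iff) (auto simp: entry_zero)
qed (use assms cop.subspace_0[OF subspace_linear_ops] in auto)

lemma hs_rank_one: "X \<in> linear_ops \<Longrightarrow> hs (rank_one u) X = cinner u (X u)"
  using op_trace_comp[OF pos_semidef_rank_one[of u], of X] op_trace_rank_one_comp[of X u]
  by (simp add: hs_def)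

lemma op_trace_entry: "(X::'h oper) \<in> linear_ops \<Longrightarrow> op_trace X = (\<Sum>i\<in>{1..d}. entry X (i, i))"
  by (simp add: op_trace_basis entry_def)

lemma sum_idx_diag:
  "(\<Sum>p\<in>idx. if fst p = snd p then f p else 0) = (\<Sum>i\<in>{1..d}. f (i, i))"
  for f :: "nat \<times> nat \<Rightarrow> complex"
  unfolding sum.cartesian_product' by (intro sum.cong refl) simp

lemma hs_id_right: "X \<in> linear_ops \<Longrightarrow> hs X id = cnj (op_trace X)"
proof -
  assume X: "X \<in> linear_ops"
  have "hs X id = (\<Sum>p\<in>idx. if fst p = snd p then cnj (entry X p) else 0)"
    unfolding hs_def by (intro sum.cong) (auto simp: entry_id)
  then show ?thesis by (simp add: sum_idx_diag op_trace_entry[OF X])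
qed

text \<open>All diagonal entries are real and nonnegative. For the middle bound, Cauchy-Schwarz
  estimates the squared entry at \<open>(i, j)\<close> by \<open>t i * t j\<close>, and the sum over
  all pairs factors into the squared trace.\<close>

lemma pos_semidef_op_trace:
  fixes A :: "'h oper"
  assumes A: "pos_semidef A"
  shows "op_trace A = of_real (Re (op_trace A))"
    "(\<Sum>p\<in>idx. (cmod (entry A p))\<^sup>2) \<le> (Re (op_trace A))\<^sup>2" "0 \<le> Re (op_trace A)"
proof -
  define t where "t i = Re (cinner (e i) (A (e i)))" for i
  have tr: "op_trace A = of_real (\<Sum>i\<in>{1..d}. t i)"
    using pos_semidef_diag(1)[OF A] by (simp add: op_trace_basis[OF pos_semidef_linear[OF A]] t_def)
  then show "op_trace A = of_real (Re (op_trace A))" by simp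
  show "0 \<le> Re (op_trace A)" using tr pos_semidef_diag(2)[OF A] by (simp add: t_def sum_nonneg)
  have "(\<Sum>p\<in>idx. (cmod (entry A p))\<^sup>2) \<le> (\<Sum>p\<in>idx. t (fst p) * t (snd p))"
    by (intro sum_mono) (auto simp: entry_def t_def pos_semidef_cauchy_schwarz[OF A])
  also have "\<dots> = (Re (op_trace A))\<^sup>2"
    by (simp add: tr power2_eq_square sum_product sum.cartesian_product case_prod_beta)
  finally show "(\<Sum>p\<in>idx. (cmod (entry A p))\<^sup>2) \<le> (Re (op_trace A))\<^sup>2" .
qed

text \<open>A vanishing trace would force all entries to vanish by the preceding bound. Hence the
  denominators in the scaled frame operator of a POVM are nonzero.\<close>

lemma pos_semidef_op_trace_nonzero:
  fixes A :: "'h oper"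
  assumes A: "pos_semidef A" "A \<noteq> 0"
  shows "op_trace A \<noteq> 0"
proof
  assume "op_trace A = 0"
  then have "(\<Sum>p\<in>idx. (cmod (entry A p))\<^sup>2) = 0"
    using pos_semidef_op_trace(2)[OF A(1)] sum_nonneg[of idx "\<lambda>p. (cmod (entry A p))\<^sup>2"] by simp
  then have "hs A A = 0" unfolding hs_self by (simp only: of_real_0)
  then show False using hs_self_eq_0 pos_semidef_linear A by blast
qed

text \<open>The matrix of the scaled frame operator with respect to the matrix units.\<close>

definition frame_kernel :: "'i set \<Rightarrow> ('i \<Rightarrow> 'h oper) \<Rightarrow> nat \<times> nat \<Rightarrow> nat \<times> nat \<Rightarrow> complex" where
  "frame_kernel I A p q = (\<Sum>a\<in>I. entry (A a) p * cnj (entry (A a) q) / op_trace (A a))"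

lemma frame_kernel_hermitian:
  fixes A :: "'i \<Rightarrow> 'h oper"
  assumes "\<And>a. a \<in> I \<Longrightarrow> pos_semidef (A a)"
  shows "cnj (frame_kernel I A p q) = frame_kernel I A q p"
proof -
  have "cnj (op_trace (A a)) = op_trace (A a)" if "a \<in> I" for a
    using pos_semidef_op_trace(1)[OF assms[OF that]] by (metis complex_cnj_complex_of_real)
  then show ?thesis by (simp add: frame_kernel_def mult.commute)
qed

lemma entry_scaled_frame:
  fixes A :: "'i \<Rightarrow> 'h oper"
  assumes "\<And>a. a \<in> I \<Longrightarrow> pos_semidef (A a)" and X: "X \<in> linear_ops"
  shows "entry (scaled_frame I A X) p = (\<Sum>q\<in>idx. frame_kernel I A p q * entry X q)"
proof -
  have "entry (scaled_frame I A X) p =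
      (\<Sum>a\<in>I. \<Sum>q\<in>idx. entry (A a) p * cnj (entry (A a) q) / op_trace (A a) * entry X q)"
    unfolding scaled_frame_def entry_sum entry_scale
    using assms by (intro sum.cong refl)
      (simp add: op_trace_comp[OF _ X] sum_divide_distrib sum_distrib_left sum_distrib_right mult_ac)
  also have "\<dots> = (\<Sum>q\<in>idx. frame_kernel I A p q * entry X q)"
    unfolding frame_kernel_def sum_distrib_right by (rule sum.swap)
  finally show ?thesis .
qed

text \<open>Taking entries sends an eigenoperator to an eigenvector of the kernel; conversely an
  eigenvector supplies the coefficients of an operator in the matrix units.\<close>

lemma superop_eigenvalue_scaled_frame_iff:
  fixes A :: "'i \<Rightarrow> 'h oper"
  assumes A: "\<And>a. a \<in> I \<Longrightarrow> pos_semidef (A a)"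
  shows "superop_eigenvalue (scaled_frame I A) c \<longleftrightarrow> kernel_eigenvalue idx (frame_kernel I A) c"
proof
  assume "superop_eigenvalue (scaled_frame I A) c"
  then obtain X where X: "X \<in> linear_ops" "X \<noteq> 0" "scaled_frame I A X = op_scale c X"
    by (auto simp: superop_eigenvalue_def)
  have "\<exists>p\<in>idx. entry X p \<noteq> 0"
    using linear_op_eqI[OF X(1) cop.subspace_0[OF subspace_linear_ops]] X(2)
    unfolding entry_zero by blast
  moreover have "(\<Sum>q\<in>idx. frame_kernel I A p q * entry X q) = c * entry X p" for p
    by (simp add: entry_scaled_frame[where I = I and A = A and X = X, OF A X(1), symmetric]
        X(3) entry_scale)
  ultimately show "kernel_eigenvalue idx (frame_kernel I A) c"
    unfolding kernel_eigenvalue_def by blast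
next
  assume "kernel_eigenvalue idx (frame_kernel I A) c"
  then obtain v where v: "\<exists>p\<in>idx. v p \<noteq> 0"
    "\<And>p. p \<in> idx \<Longrightarrow> (\<Sum>q\<in>idx. frame_kernel I A p q * v q) = c * v p"
    unfolding kernel_eigenvalue_def by blast
  define X where "X = (\<Sum>p\<in>idx. op_scale (v p) (unit_op p))"
  have X: "X \<in> linear_ops" unfolding X_def
    by (intro cop.subspace_sum cop.subspace_scale subspace_linear_ops linear_ops_unit_op)
  have entry: "entry X q = v q" if q: "q \<in> idx" for q
  proof -
    have "entry X q = (\<Sum>p\<in>idx. if p = q then v p else 0)"
      unfolding X_def entry_sum entry_scale using q by (intro sum.cong) (auto simp: entry_unit_op)
    then show ?thesis using q by simp
  qed
  have "scaled_frame I A X = op_scale c X"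
  proof (rule linear_op_eqI)
    show "scaled_frame I A X \<in> linear_ops"
      using A pos_semidef_linear by (intro linear_ops_scaled_frame) auto
    show "op_scale c X \<in> linear_ops" by (intro cop.subspace_scale subspace_linear_ops X)
    fix p assume p: "p \<in> idx"
    show "entry (scaled_frame I A X) p = entry (op_scale c X) p"
      using v(2)[OF p] p entry
      by (simp add: entry_scaled_frame[where I = I and A = A and X = X, OF A X] entry_scale cong: sum.cong)
  qed
  moreover have "X \<noteq> 0" using v(1) entry by (auto simp: entry_zero)
  ultimately show "superop_eigenvalue (scaled_frame I A) c"
    using X by (auto simp: superop_eigenvalue_def)
qed

text \<open>Each effect contributes its squared Hilbert-Schmidt norm divided by its trace, which is
  at most its trace; the effects add up to \<open>id\<close>, of trace \<open>d\<close>.\<close>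

lemma frame_kernel_trace_le:
  fixes A :: "'i \<Rightarrow> 'h oper"
  assumes povm: "povm I A"
  shows "Re (\<Sum>p\<in>idx. frame_kernel I A p p) \<le> real d"
proof -
  have A: "pos_semidef (A a)" if "a \<in> I" for a using povm that by (simp add: povm_def)
  define t where "t a = Re (op_trace (A a))" for a
  have t: "op_trace (A a) = of_real (t a)" "(\<Sum>p\<in>idx. (cmod (entry (A a) p))\<^sup>2) \<le> (t a)\<^sup>2" "0 \<le> t a"
    if "a \<in> I" for a
    using pos_semidef_op_trace[OF A[OF that]] by (simp_all add: t_def)
  have "(\<Sum>p\<in>idx. frame_kernel I A p p) =
      (\<Sum>a\<in>I. of_real ((\<Sum>p\<in>idx. (cmod (entry (A a) p))\<^sup>2) / t a))"
    unfolding frame_kernel_def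
    by (subst sum.swap, intro sum.cong refl)
      (simp add: t(1) sum_divide_distrib complex_norm_square del: of_real_power)
  also have "Re \<dots> = (\<Sum>a\<in>I. (\<Sum>p\<in>idx. (cmod (entry (A a) p))\<^sup>2) / t a)"
    by (simp only: Re_sum Re_complex_of_real)
  also have "\<dots> \<le> (\<Sum>a\<in>I. t a)"
  proof (rule sum_mono)
    fix a assume a: "a \<in> I"
    show "(\<Sum>p\<in>idx. (cmod (entry (A a) p))\<^sup>2) / t a \<le> t a"
    \<comment> \<open>If \<open>t a = 0\<close>, the quotient is 0 by the convention for division by
      zero.\<close>
    proof (cases "t a = 0")
      case False
      then show ?thesis using t(2,3)[OF a] by (simp add: divide_le_eq power2_eq_square)
    qed simp
  qed
  also have "\<dots> = Re (op_trace (\<Sum>a\<in>I. A a))"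
    using A pos_semidef_linear by (subst op_trace_sum) (auto simp: t_def)
  also have "\<dots> = real d" using povm by (simp add: povm_def op_trace_id)
  finally show ?thesis .
qed

text \<open>At \<open>X = id\<close> every coefficient is a nonzero trace divided by itself, so the
  effects simply add up to \<open>id\<close>; \<open>1 \<le> d\<close> ensures that
  \<open>id\<close> is not the zero operator.\<close>

lemma superop_eigenvalue_one:
  fixes A :: "'i \<Rightarrow> 'h oper"
  assumes povm: "povm I A" and d: "1 \<le> d"
  shows "superop_eigenvalue (scaled_frame I A) 1"
proof -
  have "scaled_frame I A id = (\<Sum>a\<in>I. A a)"
    unfolding scaled_frame_def
    using povm pos_semidef_op_trace_nonzero by (intro sum.cong) (auto simp: povm_def)
  then have "scaled_frame I A id = op_scale 1 id" using povm by (simp add: povm_def)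
  moreover have "(id :: 'h oper) \<noteq> 0"
    using entry_id[of "(1, 1)"] entry_zero[of "(1, 1)"] d by auto
  ultimately show ?thesis using linear_ops_id unfolding superop_eigenvalue_def by blast
qed

text \<open>Lets \<open>Min\<close> in \<open>completeness_stability\<close> be a true
  minimum.\<close>

lemma finite_frame_eigenvalues:
  fixes A :: "'i \<Rightarrow> 'h oper"
  assumes A: "\<And>a. a \<in> I \<Longrightarrow> pos_semidef (A a)"
  shows "finite {r. superop_eigenvalue (scaled_frame I A) (complex_of_real r)}"
proof -
  have idx: "finite idx" by simp
  obtain es where "\<And>c. kernel_eigenvalue idx (frame_kernel I A) c \<longleftrightarrow> c \<in> set es"
    using kernel_spectrum[OF idx, of "frame_kernel I A"] by metis
  then have "{r. superop_eigenvalue (scaled_frame I A) (complex_of_real r)} \<subseteq> Re ` set es"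
    using superop_eigenvalue_scaled_frame_iff[where I = I and A = A, OF A] by force
  then show ?thesis by (rule finite_subset) simp
qed

text \<open>The smallest eigenvalue is at most the average over the spectrum with one eigenvalue 1
  removed, and the trace bound controls that average.\<close>

lemma completeness_stability_le:
  fixes A :: "'i \<Rightarrow> 'h oper"
  assumes povm: "povm I A" and d: "2 \<le> d"
  shows "completeness_stability I A \<le> 1 / (real d + 1)"
proof -
  have A: "pos_semidef (A a)" if "a \<in> I" for a using povm that by (simp add: povm_def)
  note iff = superop_eigenvalue_scaled_frame_iff[where I = I and A = A, OF A]
  have one: "kernel_eigenvalue idx (frame_kernel I A) 1"
    using superop_eigenvalue_one[OF povm] d iff by simp
  have idx: "finite idx" by simp
  have herm: "cnj (frame_kernel I A p q) = frame_kernel I A q p" for p q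
    using A by (rule frame_kernel_hermitian)
  obtain r where r: "kernel_eigenvalue idx (frame_kernel I A) (complex_of_real r)"
    "1 + (real (card idx) - 1) * r \<le> Re (\<Sum>p\<in>idx. frame_kernel I A p p)"
    using hermitian_kernel_min_eigenvalue[of idx "frame_kernel I A", OF idx herm one] by blast
  have "1 + (real d * real d - 1) * r \<le> real d"
    using r(2) frame_kernel_trace_le[OF povm] by (simp add: card_cartesian_product)
  \<comment> \<open>Factoring \<open>d\<^sup>2 - 1\<close> exposes the common factor
    \<open>d - 1\<close>, positive because \<open>2 \<le> d\<close>.\<close>
  then have "(real d - 1) * ((real d + 1) * r) \<le> (real d - 1) * 1"
    by (simp add: algebra_simps)
  then have "(real d + 1) * r \<le> 1"
    using d by (subst (asm) mult_le_cancel_left_pos) auto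
  then have "r \<le> 1 / (real d + 1)" by (simp add: field_simps)
  moreover have "completeness_stability I A \<le> r"
    unfolding completeness_stability_def
    using finite_frame_eigenvalues[where I = I and A = A, OF A] r(1) iff by (intro Min_le) auto
  ultimately show ?thesis by simp
qed

end

subsection \<open>Mutually unbiased bases\<close>

lemma (in orthonormal) op_trace_rank_one: "op_trace (rank_one u :: 'h oper) = cinner u u"
  unfolding op_trace_basis[OF linear_ops_rank_one] parseval[of u u]
  by (simp add: rank_one_def cinner_scaleC_right mult.commute)

lemma (in orthonormal) sum_rank_one: "(\<Sum>i\<in>{1..d}. rank_one (e i)) = id"
  by (rule ext) (simp add: sum_fun_apply rank_one_def basis_expansion[symmetric])

locale mub =
  fixes k d :: nat and m :: "nat \<Rightarrow> nat \<Rightarrow> 'h::fin_dim_complex_hilbert"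
  assumes mub: "mutually_unbiased_bases k m" and d_eq: "d = dimC TYPE('h)"
begin

definition J :: "(nat \<times> nat) set" where "J = {1..k} \<times> {1..d}"

abbreviation vec_at :: "nat \<times> nat \<Rightarrow> 'h" where "vec_at s \<equiv> m (fst s) (snd s)"

lemma k_ge_1: "1 \<le> k"
  using mub by (simp add: mutually_unbiased_bases_def)

lemma onb_at: "j \<in> {1..k} \<Longrightarrow> orthonormal d (m j)"
  using mub by (simp add: mutually_unbiased_bases_def orthonormal_def d_eq)

text \<open>The first of the given bases serves as the reference basis for entries and traces; it
  exists because \<open>1 \<le> k\<close>.\<close>

sublocale orthonormal d "m 1"
  using onb_at k_ge_1 by simp

lemma mub_index_eq: "mub_index TYPE('h) k = J"
  by (simp add: mub_index_def J_def flip: d_eq)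

lemma sum_J: "(\<Sum>s\<in>J. f s) = (\<Sum>j\<in>{1..k}. \<Sum>a\<in>{1..d}. f (j, a))"
  for f :: "nat \<times> nat \<Rightarrow> 'b::comm_monoid_add"
  by (simp add: J_def sum.cartesian_product)

lemma cinner_vec_at_self: "s \<in> J \<Longrightarrow> cinner (vec_at s) (vec_at s) = 1"
  using orthonormal.cinner_basis[OF onb_at, of "fst s" "snd s" "snd s"] by (auto simp: J_def)

lemma sum_rank_one_at: "j \<in> {1..k} \<Longrightarrow> (\<Sum>a\<in>{1..d}. rank_one (m j a)) = id"
  using orthonormal.sum_rank_one[OF onb_at] .

lemma overlap:
  assumes "j \<in> {1..k}" "a \<in> {1..d}" "s \<in> J"
  shows "cinner (m j a) (rank_one (vec_at s) (m j a)) =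
    (if j = fst s then (if a = snd s then 1 else 0) else 1 / of_nat d)"
proof (cases "j = fst s")
  case True
  then show ?thesis
    using assms orthonormal.cinner_basis[OF onb_at, of j a "snd s"]
    by (auto simp: cinner_rank_one J_def)
next
  case False
  then have "(cmod (cinner (m j a) (vec_at s)))\<^sup>2 = 1 / real d"
    using assms mub by (auto simp: J_def mutually_unbiased_bases_def simp flip: d_eq)
  then show ?thesis using False by (simp add: cinner_rank_one del: of_real_power)
qed

text \<open>The map called \<open>Q\<close> in the introduction, with \<open>Tr (P X)\<close>
  written as a diagonal inner product. The multiple of \<open>id\<close> compensates for the
  contributions of foreign bases.\<close>

definition frame_proj :: "'h oper \<Rightarrow> 'h oper" where
  "frame_proj X = (\<Sum>s\<in>J. op_scale (cinner (vec_at s) (X (vec_at s))) (rank_one (vec_at s)))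
     + op_scale ((1 - of_nat k) / of_nat d * op_trace X) id"

lemma linear_ops_frame_proj: "frame_proj X \<in> linear_ops"
  unfolding frame_proj_def
  by (intro cop.subspace_add cop.subspace_sum cop.subspace_scale subspace_linear_ops
      linear_ops_rank_one linear_ops_id)

lemma frame_proj_add:
  assumes "X \<in> linear_ops" "Y \<in> linear_ops"
  shows "frame_proj (X + Y) = frame_proj X + frame_proj Y"
  by (simp add: frame_proj_def op_trace_add[OF assms] cinner_add_right cop.scale_left_distrib
      sum.distrib ring_distribs)

lemma frame_proj_scale:
  assumes "X \<in> linear_ops"
  shows "frame_proj (op_scale c X) = op_scale c (frame_proj X)"
proof -
  have "cinner u (op_scale c X u) = c * cinner u (X u)" for u
    by (simp add: op_scale_def cinner_scaleC_right)
  then show ?thesis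
    by (simp add: frame_proj_def op_trace_scale[OF assms] cop.scale_right_distrib
        cop.scale_sum_right mult_ac)
qed

text \<open>The basis containing the vector reproduces \<open>?P\<close>, and by unbiasedness each
  of the other \<open>k - 1\<close> bases contributes \<open>id\<close> divided by \<open>d\<close>.
  Since \<open>?P\<close> has trace 1, the correction term cancels exactly these
  contributions.\<close>

lemma frame_proj_rank_one:
  assumes s: "s \<in> J" and d: "1 \<le> d"
  shows "frame_proj (rank_one (vec_at s)) = rank_one (vec_at s)"
proof -
  let ?P = "rank_one (vec_at s)"
  have inner: "(\<Sum>a\<in>{1..d}. op_scale (cinner (m j a) (?P (m j a))) (rank_one (m j a))) =
      (if j = fst s then ?P else op_scale (1 / of_nat d) id)" if j: "j \<in> {1..k}" for j
  proof (cases "j = fst s")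
    case True
    have "(\<Sum>a\<in>{1..d}. op_scale (cinner (m j a) (?P (m j a))) (rank_one (m j a))) =
        (\<Sum>a\<in>{1..d}. if a = snd s then ?P else 0)"
      using True j s by (intro sum.cong refl) (simp add: overlap)
    also have "\<dots> = ?P" using s by (simp add: J_def mem_Times_iff)
    finally show ?thesis using True by simp
  next
    case False
    have "(\<Sum>a\<in>{1..d}. op_scale (cinner (m j a) (?P (m j a))) (rank_one (m j a))) =
        (\<Sum>a\<in>{1..d}. op_scale (1 / of_nat d) (rank_one (m j a)))"
      using False j s by (intro sum.cong refl) (simp add: overlap)
    also have "\<dots> = op_scale (1 / of_nat d) id"
      unfolding cop.scale_sum_right[symmetric] sum_rank_one_at[OF j] ..
    finally show ?thesis using False by simp
  qed
  have s1: "fst s \<in> {1..k}" using s by (auto simp: J_def)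
  have "(\<Sum>t\<in>J. op_scale (cinner (vec_at t) (?P (vec_at t))) (rank_one (vec_at t))) =
      (\<Sum>j\<in>{1..k}. if j = fst s then ?P else op_scale (1 / of_nat d) id)"
    unfolding sum_J fst_conv snd_conv by (intro sum.cong refl inner)
  also have "\<dots> = ?P + (\<Sum>j\<in>{1..k} - {fst s}. op_scale (1 / of_nat d) id)"
    using s1 by (subst sum.remove[of _ "fst s"]) (auto intro!: sum.cong)
  finally have sum: "(\<Sum>t\<in>J. op_scale (cinner (vec_at t) (?P (vec_at t))) (rank_one (vec_at t))) =
      ?P + (\<Sum>j\<in>{1..k} - {fst s}. op_scale (1 / of_nat d) id)" .
  have others: "(\<Sum>j\<in>{1..k} - {fst s}. op_scale (1 / of_nat d) id) =
      op_scale ((of_nat k - 1) / of_nat d) (id :: 'h oper)"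
    using s1 k_ge_1 unfolding cop.scale_sum_left[symmetric] by (simp add: of_nat_diff)
  have "frame_proj ?P = ?P + (op_scale ((of_nat k - 1) / of_nat d) id
      + op_scale ((1 - of_nat k) / of_nat d) id)"
    unfolding frame_proj_def sum others op_trace_rank_one cinner_vec_at_self[OF s]
    by (simp only: add.assoc mult_1_right)
  also have "\<dots> = ?P"
    unfolding cop.scale_left_distrib[symmetric] by (simp add: diff_divide_distrib)
  finally show ?thesis .
qed

section \<open>The effects of the MUB-POVM and their span\<close>

lemma mub_effect_eq: "mub_effect k m s = op_scale (1 / of_nat k) (rank_one (vec_at s))"
  by (cases s) (simp add: mub_effect_def)

lemma sum_mub_effect: "(\<Sum>s\<in>J. mub_effect k m s) = id"
proof -
  have "(\<Sum>s\<in>J. mub_effect k m s) =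
      op_scale (1 / of_nat k) (\<Sum>j\<in>{1..k}. \<Sum>a\<in>{1..d}. rank_one (m j a))"
    unfolding mub_effect_eq cop.scale_sum_right[symmetric] sum_J by simp
  also have "\<dots> = op_scale (1 / of_nat k) (\<Sum>j\<in>{1..k}. op_scale 1 id)"
    by (simp add: sum_rank_one_at)
  also have "\<dots> = id"
    unfolding cop.scale_sum_left[symmetric] cop.scale_scale using k_ge_1 by simp
  finally show ?thesis .
qed

lemma povm_mub: "povm J (mub_effect k m)"
proof -
  have "pos_semidef (mub_effect k m s)" for s
  proof -
    have "cinner x (mub_effect k m s x) = of_real ((cmod (cinner x (vec_at s)))\<^sup>2 / real k)" for x
      by (simp add: mub_effect_eq op_scale_def cinner_scaleC_right cinner_rank_one del: of_real_power)
    moreover have "mub_effect k m s \<in> linear_ops"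
      unfolding mub_effect_eq by (intro cop.subspace_scale subspace_linear_ops linear_ops_rank_one)
    ultimately show ?thesis by (simp add: pos_semidef_def del: of_real_power of_real_divide)
  qed
  moreover have "mub_effect k m s \<noteq> 0" if s: "s \<in> J" for s
  proof
    assume "mub_effect k m s = 0"
    then have "cinner (vec_at s) (mub_effect k m s (vec_at s)) = 0" by simp
    then show False
      using k_ge_1 by (simp add: mub_effect_eq op_scale_def cinner_scaleC_right cinner_rank_one
          cinner_vec_at_self[OF s])
  qed
  moreover have "finite J" by (simp add: J_def)
  ultimately show ?thesis by (simp add: povm_def sum_mub_effect)
qed

lemma rank_one_in_span: "s \<in> J \<Longrightarrow> rank_one (vec_at s) \<in> cop.span (mub_effect k m ` J)"
proof -
  assume s: "s \<in> J"
  have "op_scale (of_nat k) (mub_effect k m s) = rank_one (vec_at s)"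
    using k_ge_1 by (simp add: mub_effect_eq)
  then show ?thesis using s by (metis cop.span_base cop.span_scale imageI)
qed

text \<open>The correction term stays in the span because \<open>id\<close> is the sum of the
  effects.\<close>

lemma frame_proj_in_span: "frame_proj X \<in> cop.span (mub_effect k m ` J)"
proof -
  have "id \<in> cop.span (mub_effect k m ` J)"
    unfolding sum_mub_effect[symmetric] by (intro cop.span_sum cop.span_base imageI)
  then show ?thesis unfolding frame_proj_def
    by (intro cop.span_add cop.span_sum cop.span_scale rank_one_in_span)
qed

text \<open>The linear fixed points form a subspace, and it contains every effect.\<close>

lemma frame_proj_fixes_span:
  assumes X: "X \<in> cop.span (mub_effect k m ` J)" and d: "1 \<le> d"
  shows "frame_proj X = X"
proof -
  have "cop.subspace {X \<in> linear_ops. frame_proj X = X}"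
    using subspace_linear_ops frame_proj_scale[of 0 0] cop.subspace_0[OF subspace_linear_ops]
    by (auto simp: cop.subspace_def frame_proj_add frame_proj_scale)
  moreover have "mub_effect k m ` J \<subseteq> {X \<in> linear_ops. frame_proj X = X}"
    using d by (intro image_subsetI)
      (simp add: mub_effect_eq frame_proj_scale linear_ops_rank_one frame_proj_rank_one
        cop.subspace_scale[OF subspace_linear_ops])
  ultimately show ?thesis using X cop.span_minimal by blast
qed

text \<open>The trace of \<open>frame_proj\<close> as a map on operators. Each of the
  \<open>k * d\<close> projectors contributes its squared Hilbert-Schmidt norm 1, and the
  \<open>d\<close> diagonal matrix units together contribute \<open>1 - k\<close> through the
  correction term.\<close>

lemma frame_proj_trace:
  assumes d: "1 \<le> d"
  shows "(\<Sum>p\<in>idx. entry (frame_proj (unit_op p)) p) = of_nat (k * d) + 1 - of_nat k"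
proof -
  define c :: complex where "c = (1 - of_nat k) / of_nat d"
  have tr: "op_trace (unit_op p) = (if fst p = snd p then 1 else 0)" if p: "p \<in> idx" for p
  proof -
    have "op_trace (unit_op p) = (\<Sum>i\<in>{1..d}. if p = (i, i) then 1 else 0)"
      using p unfolding op_trace_entry[OF linear_ops_unit_op]
      by (intro sum.cong refl) (simp add: entry_unit_op)
    also have "\<dots> = (\<Sum>i\<in>{1..d}. if i = fst p then (if fst p = snd p then 1 else 0) else 0)"
      by (intro sum.cong refl) (auto simp: prod_eq_iff)
    finally show ?thesis using p by auto
  qed
  \<comment> \<open>With this the sum over all matrix units becomes the squared norm of a projector,
    computed in \<open>norm\<close>.\<close>
  have unit: "cinner u (unit_op p u) = cnj (entry (rank_one u) p)" for u p
    by (cases p) (simp add: unit_op_def entry_rank_one cinner_scaleC_right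
        cinner_commute[symmetric])
  have norm: "(\<Sum>p\<in>idx. cnj (entry (rank_one u) p) * entry (rank_one u) p) = cinner u u * cinner u u" for u
    using hs_rank_one[OF linear_ops_rank_one, of u u]
    by (simp add: hs_def rank_one_def cinner_scaleC_right)
  have "(\<Sum>p\<in>idx. entry (frame_proj (unit_op p)) p) =
      (\<Sum>p\<in>idx. \<Sum>s\<in>J. cnj (entry (rank_one (vec_at s)) p) * entry (rank_one (vec_at s)) p)
        + (\<Sum>p\<in>idx. if fst p = snd p then c else 0)"
    unfolding frame_proj_def entry_add entry_sum entry_scale sum.distrib c_def unit
    by (intro arg_cong2[where f = "(+)"] sum.cong refl) (auto simp: tr entry_id)
  also have "(\<Sum>p\<in>idx. if fst p = snd p then c else 0) = 1 - of_nat k"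
    unfolding sum_idx_diag using d by (simp add: c_def)
  also have "(\<Sum>p\<in>idx. \<Sum>s\<in>J. cnj (entry (rank_one (vec_at s)) p) * entry (rank_one (vec_at s)) p)
      = (\<Sum>s\<in>J. 1)"
    by (subst sum.swap) (simp add: norm cinner_vec_at_self)
  finally show ?thesis by (simp add: J_def card_cartesian_product)
qed

text \<open>If the effects spanned all operators, \<open>frame_proj\<close> would be the identity
  there, of trace \<open>d * d\<close>; its actual trace is smaller.\<close>

lemma informationally_incomplete:
  assumes d: "2 \<le> d" and k: "k < d + 1"
  shows "\<not> informationally_complete J (mub_effect k m)"
proof
  assume "informationally_complete J (mub_effect k m)"
  then have "frame_proj (unit_op p) = unit_op p" for p
    using frame_proj_fixes_span[of "unit_op p"] d linear_ops_unit_op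
    by (simp add: informationally_complete_def)
  then have "(\<Sum>p\<in>idx. entry (frame_proj (unit_op p)) p) = of_nat (d * d)"
    by (simp add: entry_unit_op card_cartesian_product)
  then have "of_nat (k * d) + 1 - of_nat k = (of_nat (d * d) :: complex)"
    using frame_proj_trace d by simp
  \<comment> \<open>Arranged without subtraction, the equation descends to natural numbers.\<close>
  then have "of_nat (k * d + 1) = (of_nat (d * d + k) :: complex)" by (simp add: algebra_simps)
  then have eq: "k * d + 1 = d * d + k" by (simp only: of_nat_eq_iff)
  \<comment> \<open>Hence the trace is at most \<open>(d - 1) * d + 1\<close>, which is below
    \<open>d * d\<close> for \<open>2 \<le> d\<close>.\<close>
  have "(d - 1) * k \<le> (d - 1) * d" using k by simp
  then have "d * k - k \<le> d * d - d" by (simp add: diff_mult_distrib)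
  moreover have "k \<le> d * k" "d \<le> d * d" using d by simp_all
  ultimately show False using eq d unfolding mult.commute[of k d] by linarith
qed

text \<open>Self-adjointness: the expansion \<open>right\<close> goes over into its conjugate when
  \<open>X\<close> and \<open>Y\<close> are exchanged, as the coefficient of the correction term is
  real.\<close>

lemma hs_frame_proj:
  assumes X: "X \<in> linear_ops" and Y: "Y \<in> linear_ops"
  shows "hs X (frame_proj Y) = hs (frame_proj X) Y"
proof -
  have right: "hs X (frame_proj Y) =
      (\<Sum>s\<in>J. cinner (vec_at s) (Y (vec_at s)) * cnj (cinner (vec_at s) (X (vec_at s))))
        + (1 - of_nat k) / of_nat d * op_trace Y * cnj (op_trace X)"
    if X: "X \<in> linear_ops" for X Y
  proof -
    have "hs X (rank_one u) = cnj (cinner u (X u))" for u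
      using hs_commute[of X "rank_one u"] by (simp add: hs_rank_one[OF X])
    then show ?thesis
      unfolding frame_proj_def hs_add_right hs_sum_right hs_scale_right hs_id_right[OF X] by simp
  qed
  show ?thesis
    unfolding hs_commute[of "frame_proj X" Y] right[OF X] right[OF Y] by (simp add: mult_ac)
qed

text \<open>A self-adjoint idempotent of full trace is the identity. The squared norms of the
  defects \<open>D p\<close> add up to \<open>d * d\<close> minus the trace of
  \<open>frame_proj\<close>, which is 0 for \<open>k = d + 1\<close>; so every matrix unit lies in
  the span of the effects.\<close>

lemma frame_proj_maximal:
  assumes k: "k = d + 1" and d: "1 \<le> d" and X: "X \<in> linear_ops"
  shows "frame_proj X = X"
proof -
  define D where "D p = unit_op p - frame_proj (unit_op p)" for p
  have D: "D p \<in> linear_ops" for p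
    unfolding D_def
    by (intro cop.subspace_diff subspace_linear_ops linear_ops_unit_op linear_ops_frame_proj)
  have idem: "frame_proj (frame_proj Y) = frame_proj Y" for Y
    using frame_proj_fixes_span[OF frame_proj_in_span d] .
  have "hs (D p) (D p) = 1 - entry (frame_proj (unit_op p)) p" if p: "p \<in> idx" for p
    unfolding D_def hs_diff_left hs_diff_right
      hs_frame_proj[OF linear_ops_unit_op linear_ops_unit_op, symmetric]
      hs_frame_proj[OF linear_ops_unit_op linear_ops_frame_proj, symmetric] idem
    using p by (simp add: hs_unit_op entry_unit_op)
  then have "(\<Sum>p\<in>idx. hs (D p) (D p)) = (\<Sum>p\<in>idx. 1 - entry (frame_proj (unit_op p)) p)"
    by (intro sum.cong) auto
  also have "\<dots> = of_nat (d * d) - (of_nat (k * d) + 1 - of_nat k)"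
    by (simp add: sum_subtractf frame_proj_trace[OF d] card_cartesian_product)
  also have "\<dots> = 0" by (simp add: k algebra_simps)
  finally have "of_real (\<Sum>p\<in>idx. \<Sum>q\<in>idx. (cmod (entry (D p) q))\<^sup>2) = (0 :: complex)"
    unfolding hs_self of_real_sum .
  then have "(\<Sum>p\<in>idx. \<Sum>q\<in>idx. (cmod (entry (D p) q))\<^sup>2) = 0" by (simp only: of_real_eq_0_iff)
  then have "(\<Sum>q\<in>idx. (cmod (entry (D p) q))\<^sup>2) = 0" if "p \<in> idx" for p
    using that by (subst (asm) sum_nonneg_eq_0_iff) (auto simp: sum_nonneg)
  then have "D p = 0" if "p \<in> idx" for p
    using hs_self_eq_0[OF D] that unfolding hs_self by (simp only: of_real_0)
  then have "unit_op p \<in> cop.span (mub_effect k m ` J)" if "p \<in> idx" for p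
    using frame_proj_in_span[of "unit_op p"] that by (simp add: D_def)
  then have "X \<in> cop.span (mub_effect k m ` J)"
    by (subst op_eq_sum_unit_ops[OF X]) (intro cop.span_sum cop.span_scale)
  then show ?thesis using frame_proj_fixes_span d by blast
qed

text \<open>The weights \<open>1 / k\<close> cancel in the quotient of traces, and the one left on
  the effect is cleared by the factor on the left. The result is the first summand of
  \<open>frame_proj\<close>.\<close>

lemma scaled_frame_mub:
  assumes X: "X \<in> linear_ops"
  shows "op_scale (of_nat k) (scaled_frame J (mub_effect k m) X) =
    (\<Sum>s\<in>J. op_scale (cinner (vec_at s) (X (vec_at s))) (rank_one (vec_at s)))"
proof -
  have "op_trace (mub_effect k m s \<circ> X) / op_trace (mub_effect k m s) =
      cinner (vec_at s) (X (vec_at s))" if s: "s \<in> J" for s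
  proof -
    have "rank_one (vec_at s) \<circ> X \<in> linear_ops"
      by (intro linear_opsI)
        (simp_all add: linear_opsD[OF X] linear_opsD[OF linear_ops_rank_one])
    then have "op_trace (op_scale (1 / of_nat k) (rank_one (vec_at s) \<circ> X)) =
        1 / of_nat k * cinner (vec_at s) (X (vec_at s))"
      by (simp only: op_trace_scale op_trace_rank_one_comp[OF X])
    moreover have "mub_effect k m s \<circ> X = op_scale (1 / of_nat k) (rank_one (vec_at s) \<circ> X)"
      by (simp add: mub_effect_eq op_scale_def fun_eq_iff)
    moreover have "op_trace (mub_effect k m s) = 1 / of_nat k"
      by (simp add: mub_effect_eq op_trace_scale[OF linear_ops_rank_one] op_trace_rank_one
          cinner_vec_at_self[OF s])
    ultimately show ?thesis using k_ge_1 by simp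
  qed
  then show ?thesis
    unfolding scaled_frame_def cop.scale_sum_right
    using k_ge_1 by (intro sum.cong refl) (simp add: mub_effect_eq)
qed

text \<open>Pairing an eigenoperator \<open>X\<close> with the identity for
  \<open>(d + 1) F X\<close> gives \<open>(d + 1) * r * N = N + |Tr X|\<^sup>2\<close>, where
  \<open>N\<close> is its squared norm.\<close>

lemma maximal_eigenvalue_ge:
  assumes k: "k = d + 1" and d: "1 \<le> d"
    and ev: "superop_eigenvalue (scaled_frame J (mub_effect k m)) (complex_of_real r)"
  shows "1 / (real d + 1) \<le> r"
proof -
  obtain X where X: "X \<in> linear_ops" "X \<noteq> 0"
    "scaled_frame J (mub_effect k m) X = op_scale (of_real r) X"
    using ev by (auto simp: superop_eigenvalue_def)
  define N where "N = (\<Sum>p\<in>idx. (cmod (entry X p))\<^sup>2)"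
  have N: "hs X X = of_real N" unfolding N_def by (rule hs_self)
  then have "N \<noteq> 0" using hs_self_eq_0[OF X(1)] X(2) by auto
  moreover have "N \<ge> 0" by (simp add: N_def sum_nonneg)
  ultimately have "N > 0" by simp
  \<comment> \<open>For \<open>k = d + 1\<close> the coefficient \<open>(1 - k) / d\<close> in
    \<open>frame_proj\<close> is -1.\<close>
  have "op_scale (of_nat k * of_real r) X + op_scale (- op_trace X) id = X"
    using frame_proj_maximal[OF k d X(1)] d
    unfolding frame_proj_def scaled_frame_mub[OF X(1), symmetric] X(3) by (simp add: k)
  then have "hs X (op_scale (of_nat k * of_real r) X + op_scale (- op_trace X) id) = hs X X"
    by simp
  then have "of_nat k * of_real r * of_real N - op_trace X * cnj (op_trace X) = (of_real N :: complex)"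
    unfolding hs_add_right hs_scale_right hs_id_right[OF X(1)] N by simp
  then have "complex_of_real (real k * r * N - (cmod (op_trace X))\<^sup>2) = of_real N"
    by (simp add: complex_norm_square del: of_real_power)
  then have "real k * r * N - (cmod (op_trace X))\<^sup>2 = N" by (simp only: of_real_eq_iff)
  then have "1 * N \<le> (real k * r) * N" by (smt (verit) zero_le_power2)
  then have "1 \<le> real k * r" using \<open>N > 0\<close> by (simp only: mult_le_cancel_right_pos)
  then show ?thesis by (simp add: k divide_le_eq mult.commute)
qed

lemma maximal_completeness_stability:
  assumes k: "k = d + 1" and d: "1 \<le> d"
  shows "1 / (real d + 1) \<le> completeness_stability J (mub_effect k m)"
proof -
  have "finite {r. superop_eigenvalue (scaled_frame J (mub_effect k m)) (complex_of_real r)}"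
    using povm_mub by (intro finite_frame_eigenvalues) (simp add: povm_def)
  moreover have "1 \<in> {r. superop_eigenvalue (scaled_frame J (mub_effect k m)) (complex_of_real r)}"
    using superop_eigenvalue_one[OF povm_mub d] by simp
  ultimately show ?thesis
    unfolding completeness_stability_def
    using maximal_eigenvalue_ge[OF k d] by (subst Min_ge_iff) (auto intro!: exI[of _ 1])
qed

end

text \<open>For the first claim, \<open>1 / (d + 1)\<close> separates the two stabilities: it bounds
  that of any POVM from above and that of a maximal MUB-POVM from below.\<close>

theorem proposition5:
  assumes "dimC TYPE('h::fin_dim_complex_hilbert) \<ge> 2"
  shows
    "(\<forall>k (m :: nat \<Rightarrow> nat \<Rightarrow> 'h).
        mutually_unbiased_bases k m \<and> k = dimC TYPE('h) + 1 \<longrightarrow>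
        (\<forall>(I :: 'i set) (A :: 'i \<Rightarrow> 'h oper). povm I A \<longrightarrow>
          completeness_stability (mub_index TYPE('h) k) (mub_effect k m)
            \<ge> completeness_stability I A)) \<and>
     (\<forall>k (m :: nat \<Rightarrow> nat \<Rightarrow> 'h).
        mutually_unbiased_bases k m \<and> k < dimC TYPE('h) + 1 \<longrightarrow>
        \<not> informationally_complete (mub_index TYPE('h) k) (mub_effect k m))"
proof (intro conjI allI impI; elim conjE)
  fix k and m :: "nat \<Rightarrow> nat \<Rightarrow> 'h" and I :: "'i set" and A :: "'i \<Rightarrow> 'h oper"
  assume "mutually_unbiased_bases k m" and k: "k = dimC TYPE('h) + 1" and povm: "povm I A"
  then interpret mub k "dimC TYPE('h)" m by unfold_locales simp_all
  have "completeness_stability I A \<le> 1 / (real (dimC TYPE('h)) + 1)"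
    using completeness_stability_le[OF povm] assms .
  also have "\<dots> \<le> completeness_stability (mub_index TYPE('h) k) (mub_effect k m)"
    using maximal_completeness_stability k assms unfolding mub_index_eq by simp
  finally show "completeness_stability I A \<le>
      completeness_stability (mub_index TYPE('h) k) (mub_effect k m)" .
next
  fix k and m :: "nat \<Rightarrow> nat \<Rightarrow> 'h"
  assume "mutually_unbiased_bases k m" and k: "k < dimC TYPE('h) + 1"
  then interpret mub k "dimC TYPE('h)" m by unfold_locales simp_all
  show "\<not> informationally_complete (mub_index TYPE('h) k) (mub_effect k m)"
    using informationally_incomplete assms k unfolding mub_index_eq by simp
qed

end
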